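(* Let $m \le n$ be positive integers, let $\pi$ be a uniformly distributed random permutation of $[n]=\{1,\ldots,n\}$, and let $L^n_m=L^n_m(\pi)$ be the combined length (total number of elements) of all cycles of $\pi$ that contain at least one element of $[m]=\{1,\ldots,m\}$. Then: (i) $\mathbf{Pr}\bigl[L^n_m=\ell\bigr] = \dfrac{\binom{\ell-1}{m-1}}{\binom{n}{m}}$ for every integer $\ell$ with $m\le \ell\le n$. (ii) $\mathbf{E}\bigl[L^n_m\bigr]=\dfrac{m \cdot (n+1)}{m+1}$. (iii) $\mathbf{E}\bigl[(L^n_m)^{(k)}\bigr]=\dfrac{m\cdot (n+1)^{(k)}}{m+k}$ for every positive integer $k$, where $x^{(k)}$ denotes the $k$th rising factorial of $x$. (iv) $\mathbf{Var}\bigl[L^n_m\bigr]=\dfrac{m\cdot(n+1)\cdot(n-m)}{(m+1)^2\cdot(m+2)}$.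
   Context: For a positive integer $n$, $[n]=\{1,2,\ldots,n\}$ and $S_n$ is the set of all permutations of $[n]$. The probability space is $S_n$ with the uniform measure; $\pi\in S_n$ denotes the outcome. For $M\subseteq[n]$, define $C^n_M(\pi)=\bigcup_{i\in M}\{\pi^{t}(i)\mid t\in\{1,2,3,\ldots\}\}$, the set of all elements of all cycles of $\pi$ that contain at least one element of $M$ (fixed points are cycles of length 1). For $m\le n$, $L^n_m(\pi)=\bigl|C^n_{[m]}(\pi)\bigr|\in\{m,m+1,\ldots,n\}$. For positive integers $x$ and $k$, the $k$th rising factorial of $x$ is $x^{(k)}=x(x+1)\cdots(x+k-1)$. *)

theory Defs
  imports "HOL-Probability.Probability" "HOL-Combinatorics.Combinatorics"
begin

definition random_perm :: "nat \<Rightarrow> (nat \<Rightarrow> nat) pmf" where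
  "random_perm n = pmf_of_set {p. p permutes {1..n}}"

definition cycles_meeting :: "(nat \<Rightarrow> nat) \<Rightarrow> nat set \<Rightarrow> nat set" where
  "cycles_meeting p M = (\<Union>i\<in>M. orbit p i)"

lemma cycles_meeting_altdef: "cycles_meeting p M = (\<Union>i\<in>M. {(p ^^ t) i |t. t \<ge> 1})"
  by (simp add: cycles_meeting_def orbit_altdef Suc_le_eq)

(* The ground set {1..n} enters only through p: a permutation of {1..n} maps {1..m}
   into {1..n} whenever m \<le> n, so all the orbits concerned lie in {1..n}. *)
definition cycles_length :: "nat \<Rightarrow> (nat \<Rightarrow> nat) \<Rightarrow> nat" where
  "cycles_length m p = card (cycles_meeting p {1..m})"

end

theory Submission
  imports Defs
begin

text \<open>
  Every permutation of \<open>{1..n+1}\<close> arises exactly once from a permutation \<open>p\<close> of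
  \<open>{1..n}\<close> by inserting \<open>n + 1\<close>, either as a fixed point or into a cycle just before some
  \<open>b \<le> n\<close>. For \<open>m \<le> n\<close> the length \<open>L\<close> of the cycles meeting \<open>{1..m}\<close> grows by one exactly
  if \<open>b\<close> lies on one of them, so that
  \<open>(n + 1) E\<^sub>n\<^sub>+\<^sub>1[f(L)] = E\<^sub>n[L f(L + 1) + (n + 1 - L) f(L)]\<close> for every \<open>f\<close>.
  The distribution (\<open>f\<close> an indicator) and the rising factorial moments
  (where \<open>L (L + 1)\<^sup>(\<^sup>k\<^sup>) = (L + k) L\<^sup>(\<^sup>k\<^sup>)\<close> makes the recursion close up) both follow by induction
  on \<open>n\<close>, starting from \<open>n = m\<close>, where \<open>L = m\<close>.
\<close>

section \<open>Inserting a point into a cycle\<close>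

lemma cycles_meeting_closed: "y \<in> cycles_meeting p M \<Longrightarrow> p y \<in> cycles_meeting p M"
  by (auto simp: cycles_meeting_def intro: orbit.step)

lemma cycles_meeting_superset:
  assumes "permutation p"
  shows "M \<subseteq> cycles_meeting p M"
  using permutation_self_in_orbit[OF assms] by (auto simp: cycles_meeting_def)

text \<open>With the two lemmas above, this makes the union of the cycles the least superset of
  \<open>M\<close> closed under the permutation. Inclusions between such unions then reduce to
  checking a single application of the permutation.\<close>

lemma cycles_meeting_least:
  assumes "M \<subseteq> D" and "\<And>y. y \<in> D \<Longrightarrow> p y \<in> D"
  shows "cycles_meeting p M \<subseteq> D"
proof
  fix y assume "y \<in> cycles_meeting p M"
  then obtain i where "i \<in> M" "y \<in> orbit p i"
    by (auto simp: cycles_meeting_def)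
  from this(2) show "y \<in> D"
    by induction (use \<open>i \<in> M\<close> assms in auto)
qed

lemma cycles_meeting_subset:
  assumes "p permutes S" and "M \<subseteq> S"
  shows "cycles_meeting p M \<subseteq> S"
  using assms by (intro cycles_meeting_least) (auto simp: permutes_in_image)

text \<open>The new permutation sends the old preimage of \<open>b\<close> to \<open>x\<close> and
  \<open>x\<close> to \<open>b\<close>, so \<open>x\<close> is spliced into the cycle of
  \<open>b\<close> just before \<open>b\<close>. For \<open>b = x\<close> nothing changes and
  \<open>x\<close> stays a fixed point outside all cycles meeting \<open>M\<close>.\<close>

lemma cycles_meeting_transpose:
  assumes p: "p permutes S" and "finite S" and x: "x \<notin> S" and "M \<subseteq> S" and b: "b \<in> insert x S"
  shows "cycles_meeting (Transposition.transpose x b \<circ> p) M =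
    (if b \<in> cycles_meeting p M then insert x (cycles_meeting p M) else cycles_meeting p M)"
proof -
  define q where "q = Transposition.transpose x b \<circ> p"
  define C where "C = cycles_meeting p M"
  define D where "D = cycles_meeting q M"
  have q: "q permutes insert x S"
    unfolding q_def using p b
    by (intro permutes_compose permutes_swap_id) (auto intro: permutes_subset)
  have perm: "permutation p" "permutation q"
    using p q \<open>finite S\<close> finite.insertI[of S x] unfolding permutation_permutes by blast+
  have MC: "M \<subseteq> C" and MD: "M \<subseteq> D"
    using perm by (auto simp: C_def D_def cycles_meeting_superset)
  have CS: "C \<subseteq> S"
    unfolding C_def using p \<open>M \<subseteq> S\<close> by (rule cycles_meeting_subset)
  then have xC: "x \<notin> C" using x by blast
  have pC: "p y \<in> C" if "y \<in> C" for y
    using that unfolding C_def by (rule cycles_meeting_closed)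
  have qD: "q y \<in> D" if "y \<in> D" for y
    using that unfolding D_def by (rule cycles_meeting_closed)
  have px: "p x = x"
    using p x by (rule permutes_not_in)
  have qx: "q x = b"
    by (simp add: q_def px)
  have pyx: "p y = x \<longleftrightarrow> y = x" for y
    using px permutes_inj[OF p] by (metis injD)
  have q_eq: "q y = p y" if "p y \<noteq> b" "y \<noteq> x" for y
    using that by (simp add: q_def Transposition.transpose_def pyx)
  have q_pre: "q y = x" if "p y = b" for y
    using that by (simp add: q_def)
  have "D = (if b \<in> C then insert x C else C)"
  proof (cases "b \<in> C")
    case True
    have "D \<subseteq> insert x C"
      unfolding D_def
    proof (rule cycles_meeting_least)
      show "q y \<in> insert x C" if "y \<in> insert x C" for y
        using that True pC[of y] q_eq[of y] q_pre[of y] qx by (cases "y = x"; cases "p y = b") auto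
    qed (use MC in auto)
    moreover have CD: "C \<subseteq> D - {x}"
      unfolding C_def
    proof (rule cycles_meeting_least)
      show "M \<subseteq> D - {x}"
        using MD MC xC by blast
      show "p y \<in> D - {x}" if y: "y \<in> D - {x}" for y
      proof (cases "p y = b")
        case eq: True
        \<comment> \<open>The single \<open>p\<close>-step from \<open>y\<close> to \<open>b\<close>
          becomes two \<open>q\<close>-steps through \<open>x\<close>.\<close>
        then have "q (q y) = b" by (simp add: q_pre qx)
        then show ?thesis using eq qD[of y] qD[of "q y"] y True xC by auto
      next
        case False
        then show ?thesis using q_eq[of y] qD[of y] y pyx by auto
      qed
    qed
    moreover have "x \<in> D"
    proof -
      \<comment> \<open>An injective self-map of a finite set is onto, so \<open>b\<close> has its
        preimage inside \<open>C\<close>; \<open>q\<close> sends that preimage to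
        \<open>x\<close>.\<close>
      have "p ` C = C"
        using pC permutes_inj_on[OF p] finite_subset[OF CS \<open>finite S\<close>]
        by (intro endo_inj_surj) auto
      with True obtain y where "y \<in> C" "p y = b"
        by (metis imageE)
      then show ?thesis using q_pre[of y] qD[of y] CD by auto
    qed
    ultimately show ?thesis using True by auto
  next
    case False
    \<comment> \<open>Since \<open>p\<close> maps \<open>C\<close> into itself and \<open>b\<close>
      is outside, no point of \<open>C\<close> is sent to \<open>b\<close>, and \<open>q\<close>
      agrees with \<open>p\<close> on \<open>C\<close>. The converse inclusion uses this one to
      place its points in \<open>C\<close>.\<close>
    have DC: "D \<subseteq> C"
      unfolding D_def
    proof (rule cycles_meeting_least)
      show "q y \<in> C" if "y \<in> C" for y
        using that False pC[of y] q_eq[of y] xC by (cases "y = x"; cases "p y = b") auto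
    qed (use MC in auto)
    moreover have "C \<subseteq> D"
      unfolding C_def
    proof (rule cycles_meeting_least)
      show "p y \<in> D" if "y \<in> D" for y
      proof -
        have "y \<in> C" using that DC by blast
        then have "p y \<noteq> b" "y \<noteq> x" using pC[of y] False xC by auto
        then show ?thesis using q_eq[of y] qD[OF that] by simp
      qed
    qed (use MD in auto)
    ultimately show ?thesis using False by auto
  qed
  then show ?thesis by (simp add: D_def C_def q_def)
qed

lemma cycles_length_le:
  assumes "p permutes {1..n}" and "m \<le> n"
  shows "cycles_length m p \<le> n"
proof -
  have "cycles_meeting p {1..m} \<subseteq> {1..n}"
    using assms by (intro cycles_meeting_subset) auto
  from card_mono[OF _ this] show ?thesis by (simp add: cycles_length_def)
qed

lemma cycles_length_ge:
  assumes "p permutes {1..n}" and "m \<le> n"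
  shows "m \<le> cycles_length m p"
proof -
  have "cycles_meeting p {1..m} \<subseteq> {1..n}"
    using assms by (intro cycles_meeting_subset) auto
  moreover have "{1..m} \<subseteq> cycles_meeting p {1..m}"
    using assms(1) by (intro cycles_meeting_superset permutation_permutes[THEN iffD2]) auto
  ultimately show ?thesis
    using card_mono[of "cycles_meeting p {1..m}" "{1..m}"] finite_subset[of _ "{1..n}"]
    by (auto simp: cycles_length_def)
qed

text \<open>Of the \<open>n + 1\<close> choices of \<open>b\<close>, exactly as many as the current
  length lie on the relevant cycles and lengthen them; all others, including the new fixed point
  \<open>b = Suc n\<close>, leave the length alone.\<close>

lemma sum_cycles_length_insert:
  fixes f :: "nat \<Rightarrow> real"
  assumes p: "p permutes {1..n}" and "m \<le> n"
  shows "(\<Sum>b\<in>{1..Suc n}. f (cycles_length m (Transposition.transpose (Suc n) b \<circ> p))) =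
    real (cycles_length m p) * f (Suc (cycles_length m p)) +
    (real (Suc n) - real (cycles_length m p)) * f (cycles_length m p)"
proof -
  define C where "C = cycles_meeting p {1..m}"
  define L where "L = cycles_length m p"
  have CS: "C \<subseteq> {1..n}"
    unfolding C_def using assms by (intro cycles_meeting_subset) auto
  then have fin: "finite C" and Suc: "Suc n \<notin> C"
    using finite_subset by auto
  have L: "L = card C" by (simp add: L_def C_def cycles_length_def)
  have "f (cycles_length m (Transposition.transpose (Suc n) b \<circ> p)) = (if b \<in> C then f (Suc L) else f L)"
    if "b \<in> {1..Suc n}" for b
  proof -
    have "cycles_meeting (Transposition.transpose (Suc n) b \<circ> p) {1..m} = (if b \<in> C then insert (Suc n) C else C)"
      unfolding C_def using assms that by (intro cycles_meeting_transpose[where S = "{1..n}"]) auto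
    then show ?thesis using fin Suc by (simp add: cycles_length_def L)
  qed
  then have "(\<Sum>b\<in>{1..Suc n}. f (cycles_length m (Transposition.transpose (Suc n) b \<circ> p))) =
      (\<Sum>b\<in>{1..Suc n}. if b \<in> C then f (Suc L) else f L)"
    by (rule sum.cong[OF refl])
  also have "\<dots> = real (card ({1..Suc n} \<inter> C)) * f (Suc L) + real (card ({1..Suc n} - C)) * f L"
    by (simp only: sum.If_cases[OF finite_atLeastAtMost] Diff_eq Collect_mem_eq sum_constant)
  also have "{1..Suc n} \<inter> C = C" using CS by auto
  also have "card ({1..Suc n} - C) = Suc n - L"
    using CS fin by (subst card_Diff_subset) (auto simp: L)
  also have "real (Suc n - L) = real (Suc n) - real L"
    using cycles_length_le[OF assms] by (simp add: L_def of_nat_diff)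
  finally show ?thesis by (simp only: L[symmetric] L_def)
qed

section \<open>The expectation recursion\<close>

lemma finite_permutations_interval: "finite {p. p permutes {1..n::nat}}"
  by (simp add: finite_permutations)

lemma set_pmf_random_perm: "set_pmf (random_perm n) = {p. p permutes {1..n}}"
  unfolding random_perm_def
  using permutes_id by (intro set_pmf_of_set finite_permutations_interval) blast

lemma integrable_random_perm: "integrable (measure_pmf (random_perm n)) (f :: _ \<Rightarrow> real)"
  by (intro integrable_measure_pmf_finite) (simp only: set_pmf_random_perm finite_permutations_interval)

lemma expectation_random_perm:
  fixes f :: "_ \<Rightarrow> real"
  shows "measure_pmf.expectation (random_perm n) f = (\<Sum>p | p permutes {1..n}. f p) / fact n"
proof -
  have ne: "{p. p permutes {1..n}} \<noteq> {}" using permutes_id by blast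
  have card: "card {p. p permutes {1..n}} = fact n"
    by (rule card_permutations) auto
  show ?thesis
    by (simp only: random_perm_def integral_pmf_of_set[OF ne finite_permutations_interval]
      card of_nat_fact)
qed

lemma expectation_cong_random_perm:
  fixes f g :: "_ \<Rightarrow> real"
  assumes "\<And>p. p permutes {1..n} \<Longrightarrow> f p = g p"
  shows "measure_pmf.expectation (random_perm n) f = measure_pmf.expectation (random_perm n) g"
  using assms by (auto simp: expectation_random_perm)

text \<open>Averages the previous count over all \<open>p\<close>, since the pairs
  \<open>(b, p)\<close> enumerate the permutations of \<open>{1..Suc n}\<close> once each. The
  factor \<open>Suc n\<close> is the quotient of the two factorials.\<close>

lemma expectation_cycles_length_Suc:
  fixes f :: "nat \<Rightarrow> real"
  assumes "m \<le> n"
  shows "real (Suc n) * measure_pmf.expectation (random_perm (Suc n)) (\<lambda>p. f (cycles_length m p)) =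
    measure_pmf.expectation (random_perm n) (\<lambda>p.
      real (cycles_length m p) * f (Suc (cycles_length m p)) +
      (real (Suc n) - real (cycles_length m p)) * f (cycles_length m p))"
proof -
  have ins: "insert (Suc n) {1..n} = {1..Suc n}" by auto
  have "(\<Sum>q | q permutes {1..Suc n}. f (cycles_length m q)) =
      (\<Sum>b\<in>{1..Suc n}. \<Sum>p | p permutes {1..n}. f (cycles_length m (Transposition.transpose (Suc n) b \<circ> p)))"
    using sum_over_permutations_insert[of "{1..n}" "Suc n" "\<lambda>q. f (cycles_length m q)"]
    unfolding ins by simp
  also have "\<dots> = (\<Sum>p | p permutes {1..n}.
      \<Sum>b\<in>{1..Suc n}. f (cycles_length m (Transposition.transpose (Suc n) b \<circ> p)))"
    by (rule sum.swap)
  also have "\<dots> = (\<Sum>p | p permutes {1..n}.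
      real (cycles_length m p) * f (Suc (cycles_length m p)) +
      (real (Suc n) - real (cycles_length m p)) * f (cycles_length m p))"
    using assms by (intro sum.cong refl sum_cycles_length_insert) auto
  finally show ?thesis
    by (simp only: expectation_random_perm fact_Suc times_divide_eq_right)
      (rule mult_divide_mult_cancel_left, simp)
qed

lemma expectation_cycles_length_self:
  fixes f :: "nat \<Rightarrow> real"
  shows "measure_pmf.expectation (random_perm m) (\<lambda>p. f (cycles_length m p)) = f m"
proof -
  have "measure_pmf.expectation (random_perm m) (\<lambda>p. f (cycles_length m p)) =
      measure_pmf.expectation (random_perm m) (\<lambda>p. f m)"
    by (rule expectation_cong_random_perm) (metis cycles_length_le cycles_length_ge order_antisym le_refl)
  then show ?thesis by simp
qed

section \<open>Distribution and moments\<close>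

text \<open>For a rising factorial the two weights add up to the constant \<open>n + 1 + k\<close>,
  so each step multiplies the moment by \<open>(n + 1 + k) / (n + 1)\<close>, which is also the
  growth factor of \<open>pochhammer (real n + 1) k\<close>.\<close>

lemma expectation_pochhammer_cycles_length:
  assumes "1 \<le> m" and "m \<le> n"
  shows "measure_pmf.expectation (random_perm n) (\<lambda>p. pochhammer (real (cycles_length m p)) k)
    = real m * pochhammer (real n + 1) k / (real m + real k)"
  using \<open>m \<le> n\<close>
proof (induction n rule: dec_induct)
  case base
  \<comment> \<open>Both sides are \<open>pochhammer (real m) (Suc k)\<close>, with the first or the
    last factor split off; the same double expansion serves twice in the induction step.\<close>
  have "real m * pochhammer (real m + 1) k = (real m + real k) * pochhammer (real m) k"
    by (metis pochhammer_rec pochhammer_rec')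
  then show ?case
    using \<open>1 \<le> m\<close> expectation_cycles_length_self[of m "\<lambda>l. pochhammer (real l) k"]
    by (simp add: field_simps)
next
  case (step n)
  let ?L = "\<lambda>p. real (cycles_length m p)"
  let ?E = "\<lambda>n. measure_pmf.expectation (random_perm n) (\<lambda>p. pochhammer (?L p) k)"
  have "?L p * pochhammer (real (Suc (cycles_length m p))) k +
      (real (Suc n) - ?L p) * pochhammer (?L p) k =
      (real (Suc n) + real k) * pochhammer (?L p) k" for p
    using pochhammer_rec[of "?L p" k] pochhammer_rec'[of "?L p" k]
    by (simp add: algebra_simps)
  then have "real (Suc n) * ?E (Suc n) = (real (Suc n) + real k) * ?E n"
    using expectation_cycles_length_Suc[OF step.hyps(1), of "\<lambda>l. pochhammer (real l) k"]
    by simp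
  also have "\<dots> = real m * ((real (Suc n) + real k) * pochhammer (real n + 1) k) / (real m + real k)"
    by (simp only: step.IH times_divide_eq_right mult.left_commute)
  also have "(real (Suc n) + real k) * pochhammer (real n + 1) k =
      real (Suc n) * pochhammer (real (Suc n) + 1) k"
    using pochhammer_rec[of "real (Suc n)" k] pochhammer_rec'[of "real (Suc n)" k]
    by (simp add: algebra_simps)
  finally have "real (Suc n) * ?E (Suc n) =
      real (Suc n) * (real m * pochhammer (real (Suc n) + 1) k / (real m + real k))"
    by (simp only: times_divide_eq_right mult.left_commute)
  then show ?case by (subst (asm) mult_cancel_left) simp
qed

text \<open>Subtracting in the reals also covers \<open>k > j\<close>, where both binomials
  vanish.\<close>

lemma real_binomial_absorb_comp:
  "(real j - real k) * real (j choose k) = real j * real ((j - 1) choose k)"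
proof (cases "k \<le> j")
  case True
  then have "real ((j - k) * (j choose k)) = real (j * ((j - 1) choose k))"
    by (simp only: binomial_absorb_comp)
  with True show ?thesis by (simp add: of_nat_diff)
qed (simp add: binomial_eq_0)

text \<open>The range of \<open>l\<close> starts at 1 rather than \<open>m\<close> so that the
  induction hypothesis reaches \<open>l - 1\<close>; below \<open>m\<close> both sides are 0. The
  value \<open>l = 0\<close> must be excluded: for \<open>m = 1\<close> truncated subtraction would
  give the binomial the value 1.\<close>

lemma expectation_of_bool_cycles_length:
  assumes "1 \<le> m" and "m \<le> n" and "1 \<le> l" and "l \<le> n"
  shows "measure_pmf.expectation (random_perm n) (\<lambda>p. of_bool (cycles_length m p = l))
    = real ((l - 1) choose (m - 1)) / real (n choose m)"
  using \<open>m \<le> n\<close> assms(3,4)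
proof (induction n arbitrary: l rule: dec_induct)
  case base
  then show ?case
    using \<open>1 \<le> m\<close> expectation_cycles_length_self[of m "\<lambda>j. of_bool (j = l)"]
    by (cases "l = m") (auto simp: binomial_eq_0)
next
  case (step n)
  let ?E = "\<lambda>n l. measure_pmf.expectation (random_perm n) (\<lambda>p. of_bool (cycles_length m p = l)) :: real"
  let ?c = "\<lambda>j. real (j choose (m - 1))"
  obtain j where l: "l = Suc j" and j: "j \<le> n"
    using step.prems by (cases l) auto
  \<comment> \<open>Length \<open>j + 1\<close> arises from length \<open>j\<close> by growth, with
    weight \<open>j\<close>, or from length \<open>j + 1\<close> unchanged, with weight
    \<open>n + 1 - (j + 1) = n - j\<close>.\<close>
  have "(\<lambda>p. real (cycles_length m p) * of_bool (Suc (cycles_length m p) = l) +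
      (real (Suc n) - real (cycles_length m p)) * of_bool (cycles_length m p = l)) =
      (\<lambda>p. real j * of_bool (cycles_length m p = j) +
        (real n - real j) * of_bool (cycles_length m p = Suc j))"
    by (auto simp: l)
  then have rec: "real (Suc n) * ?E (Suc n) l = real j * ?E n j + (real n - real j) * ?E n (Suc j)"
    using expectation_cycles_length_Suc[OF step.hyps(1), of "\<lambda>i. of_bool (i = l)"]
    by (simp add: integrable_random_perm)
  \<comment> \<open>The induction hypothesis says nothing about lengths 0 and \<open>n + 1\<close>;
    there the weights \<open>j\<close> and \<open>n - j\<close> vanish.\<close>
  have "real j * ?E n j = real j * ?c (j - 1) / real (n choose m)"
    using step.IH[of j] j by (cases "j = 0") auto
  moreover have "(real n - real j) * ?E n (Suc j) = (real n - real j) * ?c j / real (n choose m)"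
    using step.IH[of "Suc j"] j by (cases "j = n") auto
  \<comment> \<open>Brings both terms to the common factor \<open>?c j\<close>; the coefficients
    \<open>j + 1 - m\<close> and \<open>n - j\<close> then add up to
    \<open>n + 1 - m\<close>.\<close>
  moreover have "real j * ?c (j - 1) = (real j + 1 - real m) * ?c j"
    using real_binomial_absorb_comp[of j "m - 1"] \<open>1 \<le> m\<close> by (simp add: of_nat_diff algebra_simps)
  ultimately have "real (Suc n) * ?E (Suc n) l = (real (Suc n) - real m) * ?c j / real (n choose m)"
    unfolding rec by (simp add: add_divide_distrib[symmetric]) (simp add: algebra_simps)
  also have "\<dots> = real (Suc n) * ?c j / real (Suc n choose m)"
  proof (subst frac_eq_eq)
    have "(real (Suc n) - real m) * real (Suc n choose m) = real (Suc n) * real (n choose m)"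
      using real_binomial_absorb_comp[of "Suc n" m] by simp
    then show "(real (Suc n) - real m) * ?c j * real (Suc n choose m) =
        real (Suc n) * ?c j * real (n choose m)"
      by (metis mult.assoc mult.commute)
  qed (use step.hyps in \<open>simp_all del: binomial_Suc_Suc\<close>)
  finally have "real (Suc n) * ?E (Suc n) l = real (Suc n) * (?c j / real (Suc n choose m))"
    by (simp only: times_divide_eq_right)
  then show ?case by (subst (asm) mult_cancel_left) (simp add: l)
qed

theorem proposition4:
  fixes m n :: nat
  assumes "1 \<le> m" and "m \<le> n"
  shows "(\<forall>l::nat. m \<le> l \<and> l \<le> n \<longrightarrow>
            measure_pmf.prob (random_perm n) {p. cycles_length m p = l}
              = real ((l - 1) choose (m - 1)) / real (n choose m))
    \<and> measure_pmf.expectation (random_perm n) (\<lambda>p. real (cycles_length m p))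
          = real m * (real n + 1) / (real m + 1)
    \<and> (\<forall>k::nat. 1 \<le> k \<longrightarrow>
            measure_pmf.expectation (random_perm n) (\<lambda>p. pochhammer (real (cycles_length m p)) k)
              = real m * pochhammer (real n + 1) k / (real m + real k))
    \<and> measure_pmf.variance (random_perm n) (\<lambda>p. real (cycles_length m p))
          = real m * (real n + 1) * (real n - real m) / ((real m + 1)\<^sup>2 * (real m + 2))"
proof (intro conjI allI impI)
  let ?L = "\<lambda>p. real (cycles_length m p)"
  let ?E = "measure_pmf.expectation (random_perm n)"
  note moment = expectation_pochhammer_cycles_length[OF assms]
  show "measure_pmf.prob (random_perm n) {p. cycles_length m p = l}
      = real ((l - 1) choose (m - 1)) / real (n choose m)" if "m \<le> l \<and> l \<le> n" for l
  proof -
    have "(\<lambda>p. of_bool (cycles_length m p = l)) = indicat_real {p. cycles_length m p = l}"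
      by (auto simp: indicator_def)
    then have "measure_pmf.prob (random_perm n) {p. cycles_length m p = l}
        = ?E (\<lambda>p. of_bool (cycles_length m p = l))"
      by simp
    with expectation_of_bool_cycles_length[of m n l] that assms show ?thesis by simp
  qed
  show mean: "?E ?L = real m * (real n + 1) / (real m + 1)"
    using moment[of 1] by simp
  show "?E (\<lambda>p. pochhammer (?L p) k) = real m * pochhammer (real n + 1) k / (real m + real k)" for k
    by (rule moment)
  \<comment> \<open>Since \<open>L^2 = L (L + 1) - L\<close>, the rising moments for
    \<open>k = 2\<close> and \<open>k = 1\<close> determine the variance.\<close>
  have "?E (\<lambda>p. (?L p)\<^sup>2) = ?E (\<lambda>p. pochhammer (?L p) 2 - ?L p)"
    by (simp add: numeral_2_eq_2 pochhammer_Suc algebra_simps power2_eq_square)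
  also have "\<dots> = real m * ((real n + 1) * (real n + 2)) / (real m + 2) - ?E ?L"
    using moment[of 2]
    by (simp add: integrable_random_perm) (simp add: numeral_2_eq_2 pochhammer_Suc algebra_simps)
  finally have square: "?E (\<lambda>p. (?L p)\<^sup>2) =
      real m * ((real n + 1) * (real n + 2)) / (real m + 2) - real m * (real n + 1) / (real m + 1)"
    by (simp add: mean)
  have "measure_pmf.variance (random_perm n) ?L = ?E (\<lambda>p. (?L p)\<^sup>2) - (?E ?L)\<^sup>2"
    by (intro measure_pmf.variance_eq integrable_random_perm)
  also have "\<dots> = real m * (real n + 1) * (real n - real m) / ((real m + 1)\<^sup>2 * (real m + 2))"
    unfolding square mean
    by (simp add: divide_simps add_pos_pos) (simp add: algebra_simps power2_eq_square)
  finally show "measure_pmf.variance (random_perm n) ?L =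
      real m * (real n + 1) * (real n - real m) / ((real m + 1)\<^sup>2 * (real m + 2))" .
qed

end
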